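(* Let $k,t$ be coprime positive integers with $3\le k<t$, let $G(k,t)$ be the corresponding distance graph, and let $S=(1,2,2,2,\ldots)$ be the infinite sequence whose first term equals $1$ and all of whose other terms equal $2$. Then $\chi_S(G(k,t))=5$.
   Context: For positive integers $k<t$, the distance graph $G(k,t)=G(\mathbb{Z},\{k,t\})$ is the infinite graph with vertex set $\mathbb{Z}$ in which $x,y\in\mathbb{Z}$ are adjacent if and only if $|x-y|\in\{k,t\}$. Let $G$ be a graph and $S=(s_1,s_2,\ldots)$ a non-decreasing sequence of positive integers. For a positive integer $\ell$, an $S$-packing $\ell$-coloring of $G$ is a map $f:V(G)\to\{1,\ldots,\ell\}$ such that for every $i\in\{1,\ldots,\ell\}$ and any two distinct vertices $u,v$ with $f(u)=f(v)=i$, the (shortest-path) distance between $u$ and $v$ in $G$ is greater than $s_i$. The $S$-packing chromatic number $\chi_S(G)$ is the smallest $\ell$ such that $G$ has an $S$-packing $\ell$-coloring. *)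

theory Defs
  imports "Graph_Theory.Graph_Theory" "HOL-Library.FuncSet" "HOL-Library.Extended_Nat"
begin

text \<open>
  A graph is a loopfree symmetric digraph without parallel arcs, possibly infinite;
  each undirected edge is represented by its two orientations.
\<close>

context pair_bidirected_digraph
begin

text \<open>The value is \<open>\<infinity>\<close> if \<open>u\<close> and \<open>v\<close> lie in different components.\<close>

definition graph_dist :: "'a \<Rightarrow> 'a \<Rightarrow> ereal" where
  "graph_dist u v = \<mu> (\<lambda>_. 1) u v"

text \<open>
  Sequences \<open>S = (s\<^sub>1, s\<^sub>2, \<dots>)\<close> are functions on \<^typ>\<open>nat\<close> with \<open>s\<^sub>i = S i\<close> for \<open>i \<ge> 1\<close>;
  the value \<open>S 0\<close> is never used.
\<close>

definition packing_coloring :: "(nat \<Rightarrow> nat) \<Rightarrow> nat \<Rightarrow> ('a \<Rightarrow> nat) \<Rightarrow> bool" where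
  "packing_coloring S l f \<longleftrightarrow>
     f \<in> pverts G \<rightarrow> {1..l} \<and>
     (\<forall>i\<in>{1..l}. \<forall>u\<in>pverts G. \<forall>v\<in>pverts G.
        u \<noteq> v \<and> f u = i \<and> f v = i \<longrightarrow> graph_dist u v > ereal (real (S i)))"

text \<open>
  The infimum in \<^typ>\<open>enat\<close> is a minimum if some colouring exists, and \<open>\<infinity>\<close> otherwise.
\<close>

definition packing_chromatic_number :: "(nat \<Rightarrow> nat) \<Rightarrow> enat" where
  "packing_chromatic_number S = (INF l\<in>{l. l \<ge> 1 \<and> (\<exists>f. packing_coloring S l f)}. enat l)"

end

definition distance_graph :: "nat \<Rightarrow> nat \<Rightarrow> int pair_pre_digraph" where
  "distance_graph k t = \<lparr> pverts = UNIV, parcs = {(x, y). \<bar>x - y\<bar> \<in> {int k, int t}} \<rparr>"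

lemma distance_graph_bidirected:
  assumes "k > 0" and "t > 0"
  shows "pair_bidirected_digraph (distance_graph k t)"
  using assms
  by unfold_locales
    (auto simp: distance_graph_def symmetric_def sym_def abs_minus_commute)

end

theory Submission
  imports Defs "HOL-Number_Theory.Cong"
begin

text \<open>
  If a vertex has no neighbour of colour 1, its four neighbours are pairwise at distance 2 and need
  four further colours; such a vertex exists because the neighbours of a vertex of colour 1 have
  this property. Hence five colours are necessary.

  For five colours, suppose first that \<open>k\<close> and \<open>t\<close> are odd. Colour the odd integers with 1; on the
  even integers \<open>2y\<close> the differences of \<open>y\<close> to be avoided are \<open>k\<close>, \<open>t\<close>, \<open>(t - k) / 2\<close> and
  \<open>(t + k) / 2\<close>. Exactly one of these, say \<open>m\<close>, is even, and the parities of \<open>y\<close> and \<open>y div m\<close> do.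

  Otherwise let \<open>p = 2P\<close> be the even and \<open>q\<close> the odd one of \<open>k\<close> and \<open>t\<close>. There is a height
  function \<open>h\<close> modulo 3 with \<open>h (y + P) = h y + 1\<close> and \<open>h (y + q) \<noteq> h y\<close>. An even \<open>x\<close> gets colour
  1, 2 or 3 according to \<open>h (x / 2)\<close>. For odd \<open>x\<close> the heights of \<open>x - q\<close> and \<open>x + q\<close> differ; \<open>x\<close>
  gets colour 4 if the first one is 0, colour 5 if the second one is 0, and colour 1 otherwise.
\<close>

section \<open>Packing colourings as conditions on walks with at most two arcs\<close>

context pair_bidirected_digraph
begin

lemma graph_dist_gt_iff:
  "graph_dist u v > ereal (real n) \<longleftrightarrow> (\<forall>p. awalk u p v \<longrightarrow> n < length p)"
proof -
  have cost: "awalk_cost (\<lambda>_. 1) p = real (length p)" for p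
    by (induction p) auto
  show ?thesis
  proof (intro iffI allI impI)
    fix p assume "graph_dist u v > ereal (real n)" and p: "awalk u p v"
    note \<open>graph_dist u v > ereal (real n)\<close>
    also have "graph_dist u v \<le> ereal (real (length p))"
      using min_cost_le_walk_cost[OF p, of "\<lambda>_. 1"] by (simp add: graph_dist_def cost)
    finally show "n < length p" by simp
  next
    assume *: "\<forall>p. awalk u p v \<longrightarrow> n < length p"
    \<comment> \<open>Lengths are integers, so the bound \<open>n + 1\<close> is available;
      \<open>n\<close> alone would lose strictness in the infimum.\<close>
    have "ereal (real n + 1) \<le> graph_dist u v"
      unfolding graph_dist_def \<mu>_def
    proof (rule INF_greatest)
      fix p assume "p \<in> {p. awalk u p v}"
      then have "n < length p" using * by simp
      then show "ereal (real n + 1) \<le> ereal (awalk_cost (\<lambda>_. 1) p)"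
        by (simp add: cost)
    qed
    moreover have "ereal (real n) < ereal (real n + 1)" by simp
    ultimately show "graph_dist u v > ereal (real n)" by (rule less_le_trans[rotated])
  qed
qed

lemma graph_dist_gt_1_iff:
  assumes "u \<in> pverts G"
  shows "graph_dist u v > ereal 1 \<longleftrightarrow> u \<noteq> v \<and> (u, v) \<notin> parcs G"
proof -
  have len: "length p \<le> 1 \<longleftrightarrow> p = [] \<or> (\<exists>e. p = [e])" for p :: "('a \<times> 'a) list"
    by (cases p; cases "tl p") auto
  have "(\<forall>p. awalk u p v \<longrightarrow> 1 < length p) \<longleftrightarrow> \<not> awalk u [] v \<and> (\<forall>e. \<not> awalk u [e] v)"
    using len by (metis not_less)
  then show ?thesis
    using graph_dist_gt_iff[of 1 u v] assms
    by (auto simp: awalk_simps dest: in_arcsD2)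
qed

lemma graph_dist_gt_2_iff:
  assumes "u \<in> pverts G"
  shows "graph_dist u v > ereal 2 \<longleftrightarrow>
    u \<noteq> v \<and> (u, v) \<notin> parcs G \<and> (\<nexists>w. (u, w) \<in> parcs G \<and> (w, v) \<in> parcs G)"
proof -
  have len: "length p \<le> 2 \<longleftrightarrow> p = [] \<or> (\<exists>e. p = [e]) \<or> (\<exists>e e'. p = [e, e'])"
    for p :: "('a \<times> 'a) list"
    by (cases p; cases "tl p"; cases "tl (tl p)") auto
  have "(\<forall>p. awalk u p v \<longrightarrow> 2 < length p) \<longleftrightarrow>
      \<not> awalk u [] v \<and> (\<forall>e. \<not> awalk u [e] v) \<and> (\<forall>e e'. \<not> awalk u [e, e'] v)"
    using len by (metis not_less)
  then show ?thesis
    using graph_dist_gt_iff[of 2 u v] assms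
    by (auto simp: awalk_simps dest: in_arcsD2)
qed

end

lemma pverts_distance_graph: "pverts (distance_graph k t) = UNIV"
  by (simp add: distance_graph_def)

lemma parcs_distance_graph_iff:
  "(x, y) \<in> parcs (distance_graph k t) \<longleftrightarrow> \<bar>x - y\<bar> = int k \<or> \<bar>x - y\<bar> = int t"
  by (simp add: distance_graph_def)

lemma distance_graph_commute: "distance_graph k t = distance_graph t k"
  by (simp add: distance_graph_def insert_commute)

text \<open>Since no entry of the sequence exceeds 2, packing is a local condition: it only concerns
  the ends of an arc and of two consecutive arcs.\<close>

lemma packing_coloring_distance_graph_iff:
  fixes k t :: nat
  assumes "0 < k" and "0 < t"
  shows "pair_bidirected_digraph.packing_coloring (distance_graph k t)
      (\<lambda>i. if i = 1 then 1 else 2) l f \<longleftrightarrow>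
    (\<forall>x. f x \<in> {1..l}) \<and>
    (\<forall>x y. (x, y) \<in> parcs (distance_graph k t) \<longrightarrow> f x \<noteq> f y) \<and>
    (\<forall>x y z. (x, z) \<in> parcs (distance_graph k t) \<and> (z, y) \<in> parcs (distance_graph k t) \<and>
      x \<noteq> y \<and> f x = f y \<longrightarrow> f x = 1)" (is "?P \<longleftrightarrow> ?R \<and> ?A \<and> ?B")
proof -
  interpret pair_bidirected_digraph "distance_graph k t"
    using assms by (rule distance_graph_bidirected)
  let ?E = "\<lambda>x y. (x, y) \<in> parcs (distance_graph k t)"
  define W where "W i x y \<longleftrightarrow> graph_dist x y > ereal (real (if i = 1 then 1 else 2))"
    for i :: nat and x y
  have irrefl: "\<not> ?E x x" for x
    using assms by (simp add: parcs_distance_graph_iff)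
  have W: "W i x y \<longleftrightarrow> x \<noteq> y \<and> \<not> ?E x y \<and> (i \<noteq> 1 \<longrightarrow> (\<nexists>z. ?E x z \<and> ?E z y))" for i x y
    using graph_dist_gt_1_iff[of x y] graph_dist_gt_2_iff[of x y]
    by (simp add: W_def pverts_distance_graph)
  have "?P \<longleftrightarrow> ?R \<and> (\<forall>i\<in>{1..l}. \<forall>x y. x \<noteq> y \<and> f x = i \<and> f y = i \<longrightarrow> W i x y)"
    by (simp only: packing_coloring_def pverts_distance_graph W_def Pi_iff ball_UNIV)
  also have "\<dots> \<longleftrightarrow> ?R \<and> (\<forall>x y. x \<noteq> y \<and> f x = f y \<longrightarrow> W (f x) x y)"
    by metis
  also have "(\<forall>x y. x \<noteq> y \<and> f x = f y \<longrightarrow> W (f x) x y) \<longleftrightarrow> ?A \<and> ?B" (is "?D \<longleftrightarrow> _")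
  proof
    assume D: ?D
    have ?A using D irrefl W by (metis (full_types))
    moreover have ?B using D W by blast
    ultimately show "?A \<and> ?B" ..
  next
    assume "?A \<and> ?B"
    then show ?D using W by blast
  qed
  finally show ?thesis .
qed

section \<open>Four colours do not suffice\<close>

lemma not_packing_coloring_distance_graph:
  fixes k t :: nat
  assumes "0 < k" and "k < t" and "l \<le> 4"
  shows "\<not> pair_bidirected_digraph.packing_coloring (distance_graph k t)
    (\<lambda>i. if i = 1 then 1 else 2) l f"
proof
  assume "pair_bidirected_digraph.packing_coloring (distance_graph k t)
    (\<lambda>i. if i = 1 then 1 else 2) l f"
  moreover have "0 < t" using assms by simp
  ultimately have ran: "f x \<in> {1..l}"
    and adj: "(x, y) \<in> parcs (distance_graph k t) \<Longrightarrow> f x \<noteq> f y"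
    and two: "(x, z) \<in> parcs (distance_graph k t) \<Longrightarrow> (z, y) \<in> parcs (distance_graph k t) \<Longrightarrow>
      x \<noteq> y \<Longrightarrow> f x = f y \<Longrightarrow> f x = 1" for x y z
    unfolding packing_coloring_distance_graph_iff[OF \<open>0 < k\<close> \<open>0 < t\<close>] by blast+
  define N where "N x = {x - int t, x - int k, x + int k, x + int t}" for x
  have N: "(x, y) \<in> parcs (distance_graph k t)" "(y, x) \<in> parcs (distance_graph k t)"
    if "y \<in> N x" for x y
    using that by (auto simp: N_def parcs_distance_graph_iff)
  \<comment> \<open>Start from any vertex; if it has a neighbour of colour 1, take that neighbour as
    \<open>x\<close>.\<close>
  obtain x where x: "\<And>y. y \<in> N x \<Longrightarrow> f y \<noteq> 1"
    by (metis N(1) adj)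
  have "inj_on f (N x)"
    using two N x by (metis inj_onI)
  moreover have "f ` N x \<subseteq> {2..4}"
  proof
    fix c assume "c \<in> f ` N x"
    then have "c \<noteq> 1" "c \<in> {1..l}" using x ran by auto
    then show "c \<in> {2..4}" using assms by auto
  qed
  ultimately have "card (N x) \<le> card {2..4::nat}"
    by (intro card_inj_on_le) auto
  moreover have "card (N x) = 4"
    using assms by (simp add: N_def)
  ultimately show False by simp
qed

section \<open>Five colours suffice\<close>

text \<open>Two arcs in a row add up to one of these four differences, up to sign, or to 0. Equality
  of colours is symmetric, so one sign is enough.\<close>

lemma packing_coloring_distance_graphI:
  fixes k t :: nat and f :: "int \<Rightarrow> nat"
  assumes "0 < k" and "0 < t"
    and ran: "\<And>x. f x \<in> {1..l}"
    and adj: "\<And>x. f (x + int k) \<noteq> f x" "\<And>x. f (x + int t) \<noteq> f x"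
    and two: "\<And>x. f (x + 2 * int k) = f x \<Longrightarrow> f x = 1"
      "\<And>x. f (x + 2 * int t) = f x \<Longrightarrow> f x = 1"
      "\<And>x. f (x + int k + int t) = f x \<Longrightarrow> f x = 1"
      "\<And>x. f (x + int t - int k) = f x \<Longrightarrow> f x = 1"
  shows "pair_bidirected_digraph.packing_coloring (distance_graph k t)
    (\<lambda>i. if i = 1 then 1 else 2) l f"
proof -
  let ?E = "\<lambda>x y. (x, y) \<in> parcs (distance_graph k t)"
  have E: "x = y + int k \<or> x = y + int t \<or> y = x + int k \<or> y = x + int t" if "?E x y" for x y
    using that unfolding parcs_distance_graph_iff by arith
  have A: "f x \<noteq> f y" if "?E x y" for x y
    using E[OF that] adj by metis
  have B: "f x = 1" if "?E x z" "?E z y" "x \<noteq> y" "f x = f y" for x y z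
  proof -
    have "y = x + 2 * int k \<or> x = y + 2 * int k \<or> y = x + 2 * int t \<or> x = y + 2 * int t \<or>
        y = x + int k + int t \<or> x = y + int k + int t \<or>
        y = x + int t - int k \<or> x = y + int t - int k"
      using E[OF that(1)] E[OF that(2)] by (elim disjE) (use \<open>x \<noteq> y\<close> in simp_all)
    then show ?thesis
      using two \<open>f x = f y\<close> by metis
  qed
  show ?thesis
    unfolding packing_coloring_distance_graph_iff[OF assms(1,2)] using ran A B by blast
qed

text \<open>The \<open>P\<close> steps of size \<open>q\<close> from \<open>y\<close> to
  \<open>y + P * q\<close> must together raise the height by \<open>q\<close>, and each has to be -1
  or -2 modulo 3. As \<open>P \<ge> 2\<close>, the number of steps -2 can be 0, 1 or 2, so every
  residue is attainable.\<close>

lemma exists_height: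
  fixes P q :: int
  assumes "coprime P q" and "2 \<le> P"
  shows "\<exists>h. (\<forall>y. h (y + P) = h y + 1) \<and> (\<forall>y. h (y + q) mod 3 \<noteq> h y mod (3::int))"
proof -
  obtain r where r: "[q * r = 1] (mod P)"
    using assms cong_solve_coprime_int[of q P] by (auto simp: coprime_commute)
  define m where "m = (- q - P) mod 3"
  \<comment> \<open>Coordinates: \<open>y = u y * P + v y * q\<close> with
    \<open>0 \<le> v y < P\<close>, where \<open>r\<close> inverts \<open>q\<close> modulo
    \<open>P\<close>.\<close>
  define v where "v y = (y * r) mod P" for y
  define u where "u y = (y - v y * q) div P" for y
  have "P dvd y - v y * q" for y
  proof -
    have "[v y * q = y * r * q] (mod P)"
      by (simp add: v_def cong_def mod_mult_left_eq)
    also have "[y * r * q = y] (mod P)"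
      using cong_scalar_left[OF r, of y] by (simp add: algebra_simps)
    finally show ?thesis by (metis cong_iff_dvd_diff cong_sym)
  qed
  then have uP: "u y * P = y - v y * q" for y
    by (simp add: u_def)
  have bnd: "0 \<le> v y" "v y < P" for y
    using assms by (auto simp: v_def)
  have v_P: "v (y + P) = v y" for y
    by (simp add: v_def algebra_simps)
  have u_eq: "u x = w" if "x - v x * q = w * P" for x w
    using that uP[of x] assms by simp
  have u_P: "u (y + P) = u y + 1" for y
    by (rule u_eq) (simp add: uP v_P distrib_right)
  have v_q: "v (y + q) = (v y + 1) mod P" for y
  proof -
    have "[y * r + q * r = y * r + 1] (mod P)"
      using r by (simp add: cong_add_lcancel)
    then show ?thesis by (simp add: v_def cong_def mod_add_left_eq distrib_right)
  qed
  \<comment> \<open>Going from \<open>y\<close> to \<open>y + q\<close> changes \<open>h\<close> by -2 while \<open>v y < m\<close> and by -1 afterwards. The number \<open>m\<close>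
    of double steps is such that the residue modulo 3 closes up when \<open>v\<close> wraps around.\<close>
  define h where "h y = u y - v y - min (v y) m" for y
  have "h (y + q) mod 3 \<noteq> h y mod 3" for y
  proof (cases "v y + 1 = P")
    case False
    then have v: "v (y + q) = v y + 1"
      unfolding v_q using bnd[of y] by (intro mod_pos_pos_trivial) auto
    then have "u (y + q) = u y"
      by (intro u_eq) (simp add: uP distrib_right)
    then have "h (y + q) = h y - 1 \<or> h (y + q) = h y - 2"
      by (auto simp: h_def v)
    then show ?thesis by presburger
  next
    case True
    then have v: "v (y + q) = 0" using v_q by simp
    have vy: "v y = P - 1" using True by simp
    \<comment> \<open>At the wrap-around, \<open>P\<close> copies of \<open>q\<close> are traded for
      \<open>q\<close> copies of \<open>P\<close>.\<close>
    have "u (y + q) = u y + q"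
      by (rule u_eq) (use uP[of y] in \<open>simp only: v vy, simp add: algebra_simps\<close>)
    moreover have "min 0 m = 0" by (simp add: m_def)
    ultimately have *: "h (y + q) = h y + q + P - 1 + min (P - 1) m"
      by (simp add: h_def v vy)
    \<comment> \<open>The second case is \<open>P = m = 2\<close>: the wrapping step then has to be
      a double step itself.\<close>
    have "min (P - 1) m = m \<or> m = 2 \<and> min (P - 1) m = 1"
      using assms pos_mod_bound[of 3 "- q - P"] unfolding m_def by linarith
    then have "min (P - 1) m = m \<or> min (P - 1) m = m - 1" by auto
    moreover have "(q + P + m) mod 3 = 0"
      unfolding m_def by presburger
    then obtain j where "q + P + m = 3 * j" by auto
    ultimately have "h (y + q) = h y + 3 * j - 1 \<or> h (y + q) = h y + 3 * j - 2"
      unfolding * by linarith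
    then show ?thesis by presburger
  qed
  moreover have "h (y + P) = h y + 1" for y
    by (simp add: h_def v_P u_P)
  ultimately show ?thesis by blast
qed

lemma packing_coloring_both_odd:
  fixes k t :: nat
  assumes "odd k" and "odd t" and "k < t"
  shows "\<exists>f. pair_bidirected_digraph.packing_coloring (distance_graph k t)
    (\<lambda>i. if i = 1 then 1 else 2) 5 f"
proof -
  obtain m n :: int where mn: "even m" "odd n" "0 < m"
    "int k + int t = 2 * m \<and> int t - int k = 2 * n \<or>
     int k + int t = 2 * n \<and> int t - int k = 2 * m"
  proof -
    obtain a b where ab: "int k + int t = 2 * a" "int t - int k = 2 * b"
      using assms by (metis even_add even_diff of_nat_add even_of_nat dvdE)
    \<comment> \<open>The parities differ because \<open>a + b = t\<close> is odd.\<close>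
    then have "odd a \<longleftrightarrow> even b" "0 < a" "0 < b"
      using assms by presburger+
    then show ?thesis using that ab by blast
  qed
  define c :: "int \<Rightarrow> nat" where "c y =
    (if even y then if even (y div m) then 2 else 3 else if even (y div m) then 4 else 5)" for y
  define f where "f x = (if odd x then 1 else c (x div 2))" for x
  have c_range: "c y \<in> {2..5}" for y
    by (simp add: c_def)
  have c_odd: "c (y + d) \<noteq> c y" if "odd d" for y d
    using that by (simp add: c_def)
  \<comment> \<open>Adding the even \<open>m\<close> keeps the parity of \<open>y\<close> and flips
    that of \<open>y div m\<close>.\<close>
  have c_m: "c (y + m) \<noteq> c y" for y
    using mn(1,3) by (simp add: c_def)
  have f_shift: "f (x + 2 * d) = f x \<Longrightarrow> f x = 1" if "\<And>y. c (y + d) \<noteq> c y" for x d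
    using that[of "x div 2"] by (auto simp: f_def split: if_splits)
  have "f x \<in> {1..5}" for x
    using c_range[of "x div 2"] by (simp add: f_def)
  moreover have "f (x + int k) \<noteq> f x" "f (x + int t) \<noteq> f x" for x
    using assms c_range[of "x div 2"] c_range[of "(x + int k) div 2"] c_range[of "(x + int t) div 2"]
    by (auto simp: f_def)
  moreover have "f (x + 2 * int k) = f x \<Longrightarrow> f x = 1" "f (x + 2 * int t) = f x \<Longrightarrow> f x = 1" for x
    using assms f_shift[OF c_odd[of "int k"], of x] f_shift[OF c_odd[of "int t"], of x]
    by simp_all
  moreover have "f (x + (int k + int t)) = f x \<Longrightarrow> f x = 1"
    "f (x + (int t - int k)) = f x \<Longrightarrow> f x = 1" for x
    using mn(4) f_shift[OF c_odd[OF mn(2)]] f_shift[OF c_m] by metis+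
  ultimately show ?thesis
    using assms
    by (intro exI[of _ f] packing_coloring_distance_graphI) (simp_all add: odd_pos add_diff_eq add.assoc)
qed

lemma packing_coloring_even_odd:
  fixes p q :: nat
  assumes "coprime p q" and "even p" and "4 \<le> p"
  shows "\<exists>f. pair_bidirected_digraph.packing_coloring (distance_graph p q)
    (\<lambda>i. if i = 1 then 1 else 2) 5 f"
proof -
  obtain P where P: "int p = 2 * P"
    using assms(2) by (metis dvdE even_of_nat)
  have "odd q"
    using assms by (metis coprime_common_divisor_nat coprime_def even_Suc odd_one)
  have "coprime (2 * P) (int q)"
    using assms(1) P by (metis coprime_int_iff)
  then obtain h :: "int \<Rightarrow> int" where h: "\<And>y. h (y + P) = h y + 1"
    "\<And>y. h (y + int q) mod 3 \<noteq> h y mod 3"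
    using exists_height[of P "int q"] assms P by auto
  define H where "H x = h (x div 2) mod 3" for x
  have H_range: "H x = 0 \<or> H x = 1 \<or> H x = 2" for x
    unfolding H_def by presburger
  have H_p: "H (x + int p) = (H x + 1) mod 3" for x
  proof -
    have "(x + int p) div 2 = x div 2 + P" using P by simp
    then show ?thesis by (simp add: H_def h(1) mod_add_left_eq)
  qed
  have H_q: "H (x + 2 * int q) \<noteq> H x" for x
    using h(2)[of "x div 2"] by (simp add: H_def add.commute)
  define f where "f x = (if even x then nat (1 + H x)
    else if H (x - int q) = 0 then 4 else if H (x + int q) = 0 then 5 else 1)" for x
  have f_even: "f x = nat (1 + H x)" if "even x" for x
    using that by (simp add: f_def)
  have f_odd: "f x = (if H (x - int q) = 0 then 4 else if H (x + int q) = 0 then 5 else 1)"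
    if "odd x" for x
    using that by (simp add: f_def)
  \<comment> \<open>Even vertices use 1, 2, 3 and odd ones 1, 4, 5. This settles the differences
    \<open>p + q\<close> and \<open>q - p\<close>.\<close>
  have f_eq_1: "f x = 1" if "f x = f y" "odd (x + y)" for x y
    using that H_range[of x] H_range[of y] by (auto simp: f_def split: if_splits)
  have "f x \<in> {1..5}" for x
    using H_range[of x] by (auto simp: f_def)
  moreover have "f (x + int p) \<noteq> f x" for x
  proof (cases "even x")
    case True
    then show ?thesis using H_range[of x] \<open>even p\<close> by (auto simp: f_even H_p)
  next
    case False
    \<comment> \<open>If odd \<open>x\<close> has colour 1, the heights of \<open>x - q\<close> and
      \<open>x + q\<close> are 1 and 2 in some order; adding \<open>p\<close> turns the 2 into 0, so
      colour 1 is not repeated.\<close>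
    then show ?thesis
      using H_range[of "x - int q"] H_range[of "x + int q"] \<open>even p\<close>
        H_p[of "x - int q"] H_p[of "x + int q"] H_q[of "x - int q"]
      by (auto simp: f_odd algebra_simps)
  qed
  \<comment> \<open>Only colour 1 could be shared, but an even vertex of colour 1 has height 0,
    which forces 4 or 5 on its odd neighbours at difference \<open>q\<close>.\<close>
  moreover have "f (x + int q) \<noteq> f x" for x
    using H_range[of x] H_range[of "x + int q"] \<open>odd q\<close>
    by (cases "even x") (auto simp: f_even f_odd)
  moreover have "f x = 1" if "f (x + 2 * int p) = f x" for x
  proof -
    have *: "H (y + 2 * int p) \<noteq> H y" for y
      using H_p[of y] H_p[of "y + int p"] H_range[of y] by (auto simp: add.assoc)
    show ?thesis
      using that H_range[of x] H_range[of "x + 2 * int p"] *[of x] *[of "x - int q"] *[of "x + int q"]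
      by (cases "even x") (auto simp: f_even f_odd algebra_simps split: if_splits)
  qed
  moreover have "f x = 1" if "f (x + 2 * int q) = f x" for x
    using that H_range[of x] H_range[of "x + 2 * int q"]
      H_q[of x] H_q[of "x - int q"] H_q[of "x + int q"]
    by (cases "even x") (auto simp: f_even f_odd algebra_simps split: if_splits)
  moreover have "f x = 1" if "f (x + int p + int q) = f x" for x
    using f_eq_1[of x "x + int p + int q"] that \<open>even p\<close> \<open>odd q\<close> by simp
  moreover have "f x = 1" if "f (x + int q - int p) = f x" for x
    using f_eq_1[of x "x + int q - int p"] that \<open>even p\<close> \<open>odd q\<close> by simp
  ultimately show ?thesis
    using assms \<open>odd q\<close>
    by (intro exI[of _ f] packing_coloring_distance_graphI) (auto simp: odd_pos)
qed

theorem theorem3p2: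
  fixes k t :: nat
  assumes "coprime k t" and "3 \<le> k" and "k < t"
  shows "pair_bidirected_digraph.packing_chromatic_number (distance_graph k t)
           (\<lambda>i. if i = 1 then 1 else 2) = 5"
proof -
  have "0 < k" "0 < t" using assms by auto
  then interpret pair_bidirected_digraph "distance_graph k t"
    by (rule distance_graph_bidirected)
  let ?S = "\<lambda>i. if i = 1 then 1 else 2"
  have "\<exists>f. packing_coloring ?S 5 f"
  proof (cases "even k")
    case True
    \<comment> \<open>Half of the even parameter is thus at least 2, as the height function
      requires.\<close>
    then have "4 \<le> k" using assms by presburger
    then show ?thesis using packing_coloring_even_odd[of k t] True assms by simp
  next
    case False
    show ?thesis
    proof (cases "even t")
      case True
      then show ?thesis
        using packing_coloring_even_odd[of t k] assms
        by (simp add: distance_graph_commute[of k t] coprime_commute)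
    next
      case odd_t: False
      then show ?thesis using packing_coloring_both_odd False assms by simp
    qed
  qed
  then have "packing_chromatic_number ?S \<le> enat 5"
    unfolding packing_chromatic_number_def by (intro INF_lower) auto
  moreover have "enat 5 \<le> packing_chromatic_number ?S"
    unfolding packing_chromatic_number_def
  proof (rule INF_greatest)
    fix l assume "l \<in> {l. 1 \<le> l \<and> (\<exists>f. packing_coloring ?S l f)}"
    then show "enat 5 \<le> enat l"
      using not_packing_coloring_distance_graph[OF \<open>0 < k\<close> \<open>k < t\<close>, of l] by fastforce
  qed
  ultimately show ?thesis by (simp add: numeral_eq_enat)
qed

end
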